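(* Let $G$ be an acyclic directed mixed graph (ADMG) with vertex set $V$. If $G$ has no mixed directed cycle, then $P_{l,comp}(G) = P_{m,comp}(G)$. That is, for every joint probability distribution $P$ of random variables indexed by $V$ that satisfies the composition axiom, the following are equivalent: (i) for all pairwise disjoint $X, Y, Z \subseteq V$, if $X$ is m-separated from $Y$ given $Z$ in $G$, then $I(X,Z,Y)$ holds in $P$; (ii) for every $x \in V$, $I(\{x\}, \mathrm{pa}_G(x), V \setminus \mathrm{f}(x,G))$ holds in $P$, where $\mathrm{f}(x,G) = \mathrm{pa}_G(x) \cup \mathrm{de}_G(\{x\} \cup \mathrm{sp}_G(x))$.
   Context: An acyclic directed mixed graph (ADMG) $G$ is a finite graph whose edges are directed ($\to$) or bi-directed ($\leftrightarrow$) and which has no directed cycle (consisting of $\to$ edges). A pair of vertices may be joined by both a directed and a bi-directed edge, so a path is specified by its sequence of edges as well as of (distinct) vertices. For a vertex $x$: $\mathrm{pa}_G(x) = \{v : v \to x \text{ in } G\}$ (parents); $\mathrm{sp}_G(x) = \{v : v \leftrightarrow x \text{ in } G\}$ (spouses); $\mathrm{an}_G(x) = \{v : v \to \cdots \to x \text{ in } G \text{ or } v = x\}$ (ancestors); $\mathrm{de}_G(x) = \{v : v \leftarrow \cdots \leftarrow x \text{ in } G \text{ or } v = x\}$ (descendants). For a set $A$ of vertices these are extended by unions, e.g. $\mathrm{de}_G(A) = \bigcup_{x \in A} \mathrm{de}_G(x)$. A mixed directed path from $\alpha$ to $\beta$ is a path containing at least one directed edge, in which every edge is either of the form $\gamma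 \leftrightarrow \delta$, or $\gamma \to \delta$ with $\delta$ lying between $\gamma$ and $\beta$ on the path (possibly $\delta = \beta$), i.e. directed edges point towards $\beta$. A mixed directed path from $\alpha$ to $\beta$ together with an edge $\beta \to \alpha$ or $\beta \leftrightarrow \alpha$ is a mixed directed cycle. A non-endpoint vertex $z$ on a path is a collider if two arrowheads on the path meet at $z$ ($\to z \leftarrow$, $\leftrightarrow z \leftrightarrow$, $\leftrightarrow z \leftarrow$, $\to z \leftrightarrow$); all other non-endpoint vertices are non-colliders. A path between $x$ and $y$ is m-connecting given a set $Z$ if every non-collider on the path is not in $Z$ and every collider on the path is an ancestor of a vertex in $Z$. If no path between $x$ and $y$ is m-connecting given $Z$, then $x$ and $y$ are m-separated given $Z$. Sets $X$ and $Y$ are m-separated given $Z$ if every $x \in X$ and $y \in Y$ are m-separated given $Z$. For a distribution $P$ over variables indexed by $V$ and disjoint $X,Y,Z \subseteq V$, $I(X,Z,Y)$ denotes that $X$ is conditionally independent of $Y$ given $Z$ (it holds trivially if $X$ or $Y$ is empty). $P$ satisfies the composition axiom if for all pairwise disjoint $X,Y,Z,W \subseteq V$: $I(X,Z,Y)$ and $I(X,Z,W)$ together imply $I(X,Z,Y\cup W)$. $P_{m,comp}(G)$ is the set of distributions satisfying the composition axiom and the global Markov property: $X$ m-separated from $Y$ given $Z$ in $G$ implies $I(X,Z,Y)$, for arbitrary disjoint $X,Y,Z$. $P_{l,comp}(G)$ is the set of distributions satisfying the composition axiom and: for all $x \in V$, $I(\{x\}, \mathrm{pa}_G(x), V \setminus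 \mathrm{f}(x,G))$. *)

theory Defs
  imports "HOL-Probability.Probability"
begin

section \<open>Acyclic directed mixed graphs\<close>

text \<open>
  \<open>(v, w) \<in> dir G\<close> is the edge \<open>v \<rightarrow> w\<close>; the edge \<open>v \<leftrightarrow> w\<close> is represented by both
  \<open>(v, w) \<in> bidir G\<close> and \<open>(w, v) \<in> bidir G\<close>.
\<close>

record 'v mixed_graph =
  verts :: "'v set"
  dir :: "('v \<times> 'v) set"
  bidir :: "('v \<times> 'v) set"

definition admg :: "'v mixed_graph \<Rightarrow> bool" where
  "admg G \<longleftrightarrow>
     finite (verts G) \<and>
     dir G \<subseteq> verts G \<times> verts G \<and>
     bidir G \<subseteq> verts G \<times> verts G \<and>
     sym (bidir G) \<and> irrefl (bidir G) \<and>
     acyclic (dir G)"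

definition pa :: "'v mixed_graph \<Rightarrow> 'v \<Rightarrow> 'v set" where
  "pa G x = {v. (v, x) \<in> dir G}"

definition sp :: "'v mixed_graph \<Rightarrow> 'v \<Rightarrow> 'v set" where
  "sp G x = {v. (v, x) \<in> bidir G}"

definition an :: "'v mixed_graph \<Rightarrow> 'v \<Rightarrow> 'v set" where
  "an G x = {v. (v, x) \<in> (dir G)\<^sup>*}"

definition de :: "'v mixed_graph \<Rightarrow> 'v \<Rightarrow> 'v set" where
  "de G x = {v. (x, v) \<in> (dir G)\<^sup>*}"

definition fam :: "'v \<Rightarrow> 'v mixed_graph \<Rightarrow> 'v set" where
  "fam x G = pa G x \<union> (\<Union>w\<in>{x} \<union> sp G x. de G w)"

subsection \<open>Paths\<close>

text \<open>
  An edge of a path, as traversed from \<open>v\<close> to \<open>w\<close>: \<open>Fwd\<close> is \<open>v \<rightarrow> w\<close>, \<open>Bwd\<close> is \<open>v \<leftarrow> w\<close> and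
  \<open>Bi\<close> is \<open>v \<leftrightarrow> w\<close>.
\<close>

datatype edge_kind = Fwd | Bwd | Bi

fun has_edge :: "'v mixed_graph \<Rightarrow> 'v \<Rightarrow> edge_kind \<Rightarrow> 'v \<Rightarrow> bool" where
  "has_edge G v Fwd w \<longleftrightarrow> (v, w) \<in> dir G"
| "has_edge G v Bwd w \<longleftrightarrow> (w, v) \<in> dir G"
| "has_edge G v Bi w \<longleftrightarrow> (v, w) \<in> bidir G"

text \<open>The \<open>i\<close>-th edge of the path \<open>(vs, es)\<close> joins \<open>vs ! i\<close> to \<open>vs ! Suc i\<close>.\<close>

definition is_path ::
    "'v mixed_graph \<Rightarrow> 'v \<Rightarrow> 'v list \<Rightarrow> edge_kind list \<Rightarrow> 'v \<Rightarrow> bool" where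
  "is_path G x vs es y \<longleftrightarrow>
     length vs = Suc (length es) \<and> set vs \<subseteq> verts G \<and> distinct vs \<and>
     hd vs = x \<and> last vs = y \<and>
     (\<forall>i<length es. has_edge G (vs ! i) (es ! i) (vs ! Suc i))"

definition mixed_directed_path ::
    "'v mixed_graph \<Rightarrow> 'v \<Rightarrow> 'v list \<Rightarrow> edge_kind list \<Rightarrow> 'v \<Rightarrow> bool" where
  "mixed_directed_path G a vs es b \<longleftrightarrow>
     is_path G a vs es b \<and> Fwd \<in> set es \<and> set es \<subseteq> {Fwd, Bi}"

definition has_mixed_directed_cycle :: "'v mixed_graph \<Rightarrow> bool" where
  "has_mixed_directed_cycle G \<longleftrightarrow>
     (\<exists>a b vs es. mixed_directed_path G a vs es b \<and>
        ((b, a) \<in> dir G \<or> (b, a) \<in> bidir G))"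

subsection \<open>m-separation\<close>

definition collider :: "edge_kind list \<Rightarrow> nat \<Rightarrow> bool" where
  "collider es i \<longleftrightarrow> es ! (i - 1) \<in> {Fwd, Bi} \<and> es ! i \<in> {Bwd, Bi}"

text \<open>The non-endpoint vertices of a path are the \<open>vs ! i\<close> with \<open>0 < i < length es\<close>.\<close>

definition m_connecting ::
    "'v mixed_graph \<Rightarrow> 'v list \<Rightarrow> edge_kind list \<Rightarrow> 'v set \<Rightarrow> bool" where
  "m_connecting G vs es Z \<longleftrightarrow>
     (\<forall>i. 0 < i \<and> i < length es \<longrightarrow>
        (if collider es i then vs ! i \<in> (\<Union>z\<in>Z. an G z) else vs ! i \<notin> Z))"

definition m_separated :: "'v mixed_graph \<Rightarrow> 'v set \<Rightarrow> 'v set \<Rightarrow> 'v set \<Rightarrow> bool" where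
  "m_separated G X Y Z \<longleftrightarrow>
     (\<forall>x\<in>X. \<forall>y\<in>Y. \<not> (\<exists>vs es. is_path G x vs es y \<and> m_connecting G vs es Z))"

section \<open>Conditional independence\<close>

text \<open>
  A joint distribution of random variables indexed by \<open>V\<close>, the variable with index \<open>v\<close> taking
  values in an arbitrary measurable space \<open>M v\<close>, is a probability measure on the product space
  \<open>PiM V M\<close>. The variables are the coordinate projections; of \<open>M v\<close> only the
  underlying measurable space matters.
\<close>

definition joint_distribution :: "'v set \<Rightarrow> ('v \<Rightarrow> 'a measure) \<Rightarrow> ('v \<Rightarrow> 'a) measure \<Rightarrow> bool" where
  "joint_distribution V M P \<longleftrightarrow> prob_space P \<and> sets P = sets (PiM V M)"

text \<open>The sub-sigma-algebra generated by the variables with index in \<open>A\<close>.\<close>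

definition sigma_vars ::
    "('v \<Rightarrow> 'a measure) \<Rightarrow> ('v \<Rightarrow> 'a) measure \<Rightarrow> 'v set \<Rightarrow> ('v \<Rightarrow> 'a) measure" where
  "sigma_vars M P A = vimage_algebra (space P) (\<lambda>\<omega>. restrict \<omega> A) (PiM A M)"

text \<open>
  \<open>cond_indep M P X Z Y\<close> is \<open>I(X, Z, Y)\<close>; the conditioning set is the middle argument. The
  conditional probability of an event is the conditional expectation of its indicator.
\<close>

definition cond_indep ::
    "('v \<Rightarrow> 'a measure) \<Rightarrow> ('v \<Rightarrow> 'a) measure \<Rightarrow> 'v set \<Rightarrow> 'v set \<Rightarrow> 'v set \<Rightarrow> bool" where
  "cond_indep M P X Z Y \<longleftrightarrow>
     (\<forall>A\<in>sets (sigma_vars M P X). \<forall>B\<in>sets (sigma_vars M P Y).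
        AE \<omega> in P.
          real_cond_exp P (sigma_vars M P Z) (indicator (A \<inter> B)) \<omega> =
          real_cond_exp P (sigma_vars M P Z) (indicator A) \<omega> *
          real_cond_exp P (sigma_vars M P Z) (indicator B) \<omega>)"

definition composition_axiom ::
    "'v set \<Rightarrow> ('v \<Rightarrow> 'a measure) \<Rightarrow> ('v \<Rightarrow> 'a) measure \<Rightarrow> bool" where
  "composition_axiom V M P \<longleftrightarrow>
     (\<forall>X Y Z W. X \<subseteq> V \<and> Y \<subseteq> V \<and> Z \<subseteq> V \<and> W \<subseteq> V \<and>
        disjnt X Y \<and> disjnt X Z \<and> disjnt X W \<and> disjnt Y Z \<and> disjnt Y W \<and> disjnt Z W \<and>
        cond_indep M P X Z Y \<and> cond_indep M P X Z W \<longrightarrow>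
        cond_indep M P X Z (Y \<union> W))"

section \<open>Markov properties\<close>

definition global_markov ::
    "'v mixed_graph \<Rightarrow> ('v \<Rightarrow> 'a measure) \<Rightarrow> ('v \<Rightarrow> 'a) measure \<Rightarrow> bool" where
  "global_markov G M P \<longleftrightarrow>
     (\<forall>X Y Z. X \<subseteq> verts G \<and> Y \<subseteq> verts G \<and> Z \<subseteq> verts G \<and>
        disjnt X Y \<and> disjnt X Z \<and> disjnt Y Z \<and> m_separated G X Y Z \<longrightarrow>
        cond_indep M P X Z Y)"

definition local_markov ::
    "'v mixed_graph \<Rightarrow> ('v \<Rightarrow> 'a measure) \<Rightarrow> ('v \<Rightarrow> 'a) measure \<Rightarrow> bool" where
  "local_markov G M P \<longleftrightarrow>
     (\<forall>x\<in>verts G. cond_indep M P {x} (pa G x) (verts G - fam x G))"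

definition P_m_comp :: "'v mixed_graph \<Rightarrow> ('v \<Rightarrow> 'a measure) \<Rightarrow> ('v \<Rightarrow> 'a) measure set" where
  "P_m_comp G M =
     {P. joint_distribution (verts G) M P \<and> composition_axiom (verts G) M P \<and> global_markov G M P}"

definition P_l_comp :: "'v mixed_graph \<Rightarrow> ('v \<Rightarrow> 'a measure) \<Rightarrow> ('v \<Rightarrow> 'a) measure set" where
  "P_l_comp G M =
     {P. joint_distribution (verts G) M P \<and> composition_axiom (verts G) M P \<and> local_markov G M P}"

end

theory Submission
  imports Defs
begin

text \<open>
  The local property follows from the global one because a walk leaving \<open>x\<close> that is m-connecting
  given \<open>pa G x\<close> cannot leave \<open>fam x G\<close>: a collider on it would be an ancestor of \<open>x\<close> and close a
  mixed directed cycle.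

  For the converse, let \<open>X\<close> and \<open>Y\<close> be m-separated given \<open>Z\<close> and let \<open>A\<close> be the set of ancestors of
  \<open>X \<union> Y \<union> Z\<close>. Enlarge \<open>X\<close> to \<open>X'\<close>, the vertices of \<open>A - Z\<close> reached from \<open>X\<close> by m-connecting walks, and
  let \<open>Y'\<close> be the rest of \<open>A - Z\<close>. Every district (bi-directed component) of \<open>A\<close> lies, together
  with its parents, either in \<open>X' \<union> Z\<close> or in \<open>Y' \<union> Z\<close>. Since there are no mixed directed cycles,
  \<open>A\<close> can be built up by adding one district \<open>D\<close> at a time to an ancestral set \<open>B\<close> containing the
  parents \<open>Q\<close> of \<open>D\<close>. Weak union and composition turn the local property into \<open>I(D, Q, B - Q)\<close>, and
  contraction then extends \<open>I(X', Z, Y')\<close> from \<open>B\<close> to \<open>B \<union> D\<close>.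
\<close>

section \<open>Walks and m-separation\<close>

text \<open>The flag of \<open>m_reach\<close> tells whether the last edge of the walk has an arrowhead at its end.\<close>

inductive m_reach :: "'v mixed_graph \<Rightarrow> 'v set \<Rightarrow> 'v set \<Rightarrow> 'v \<Rightarrow> bool \<Rightarrow> bool"
  for G X Z where
  start: "x \<in> X \<Longrightarrow> m_reach G X Z x False"
| step: "m_reach G X Z v h \<Longrightarrow> has_edge G v e w \<Longrightarrow>
    (if h \<and> e \<in> {Bwd, Bi} then v \<in> (\<Union>z\<in>Z. an G z) else v \<notin> Z) \<Longrightarrow>
    m_reach G X Z w (e \<in> {Fwd, Bi})"

section \<open>Walks, reachability and removal of loops\<close>

definition is_walk ::
    "'v mixed_graph \<Rightarrow> 'v \<Rightarrow> 'v list \<Rightarrow> edge_kind list \<Rightarrow> 'v \<Rightarrow> bool" where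
  "is_walk G x vs es y \<longleftrightarrow>
     length vs = Suc (length es) \<and> set vs \<subseteq> verts G \<and> hd vs = x \<and> last vs = y \<and>
     (\<forall>i<length es. has_edge G (vs ! i) (es ! i) (vs ! Suc i))"

lemma is_path_iff_walk: "is_path G x vs es y \<longleftrightarrow> is_walk G x vs es y \<and> distinct vs"
  by (auto simp: is_path_def is_walk_def)

lemma is_walk_nth:
  assumes "is_walk G x vs es y"
  shows "vs ! 0 = x" "vs ! length es = y"
proof -
  have "length vs = Suc (length es)" "hd vs = x" "last vs = y" using assms by (auto simp: is_walk_def)
  moreover from this have "vs \<noteq> []" by auto
  ultimately show "vs ! 0 = x" "vs ! length es = y" by (auto simp: hd_conv_nth last_conv_nth)
qed

lemma m_connecting_nth:
  assumes "m_connecting G vs es Z" "0 < i" "i < length es"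
  shows "if collider es i then vs ! i \<in> (\<Union>z\<in>Z. an G z) else vs ! i \<notin> Z"
  using assms unfolding m_connecting_def by blast

lemma has_edge_verts:
  assumes "admg G" "has_edge G v e w"
  shows "v \<in> verts G" "w \<in> verts G"
  using assms by (cases e; auto simp: admg_def)+

text \<open>The flag \<open>h\<close> keeps the one fact about the last edge on which the condition
  at the next interior vertex depends.\<close>

lemma m_reach_imp_walk:
  assumes "admg G" "X \<subseteq> verts G" "m_reach G X Z v h"
  shows "\<exists>x\<in>X. \<exists>vs es. is_walk G x vs es v \<and> m_connecting G vs es Z \<and>
           (h \<longleftrightarrow> es \<noteq> [] \<and> last es \<in> {Fwd, Bi})"
  using assms(3)
proof induction
  case (start x)
  then have "is_walk G x [x] [] x \<and> m_connecting G [x] [] Z"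
    using assms(2) by (auto simp: is_walk_def m_connecting_def)
  then show ?case using start by fastforce
next
  case (step v h e w)
  then obtain x vs es where x: "x \<in> X" and w: "is_walk G x vs es v" and c: "m_connecting G vs es Z"
    and h: "h \<longleftrightarrow> es \<noteq> [] \<and> last es \<in> {Fwd, Bi}"
    by blast
  have "is_walk G x (vs @ [w]) (es @ [e]) w"
    using w step.hyps(2) has_edge_verts[OF assms(1) step.hyps(2)] is_walk_nth(2)[OF w]
    unfolding is_walk_def by (auto simp: nth_append less_Suc_eq hd_append)
  moreover have "m_connecting G (vs @ [w]) (es @ [e]) Z"
    unfolding m_connecting_def
  proof (intro allI impI, elim conjE)
    fix i assume i: "0 < i" "i < length (es @ [e])"
    have len: "length vs = Suc (length es)" using w by (simp add: is_walk_def)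
    show "if collider (es @ [e]) i then (vs @ [w]) ! i \<in> (\<Union>z\<in>Z. an G z) else (vs @ [w]) ! i \<notin> Z"
    proof (cases "i < length es")
      case True
      then show ?thesis using c i len
        by (auto simp: m_connecting_def collider_def nth_append split: if_splits)
    next
      \<comment> \<open>Position \<open>length es\<close> holds \<open>v\<close>, the old endpoint,
        which the appended edge turns into an interior vertex.\<close>
      case False
      then have "i = length es" using i by simp
      then show ?thesis
        using step.hyps(3) i len is_walk_nth(2)[OF w] h
        by (auto simp: collider_def nth_append last_conv_nth split: if_splits)
    qed
  qed
  ultimately show ?case using x by (intro bexI[of _ x] exI[of _ "vs @ [w]"] exI[of _ "es @ [e]"]) auto
qed

text \<open>\<open>x \<notin> Z\<close> enters because \<open>m_reach.step\<close> tests the start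
  vertex as a non-collider, whereas \<open>m_connecting\<close> leaves endpoints free.\<close>

lemma walk_imp_m_reach:
  assumes "is_walk G x vs es y" "m_connecting G vs es Z" "x \<in> X" "x \<notin> Z"
  shows "\<exists>h. m_reach G X Z y h"
proof -
  \<comment> \<open>The guard \<open>0 < k\<close> matters: at \<open>k = 0\<close> truncated
    subtraction would make \<open>es ! (k - 1)\<close> the first edge.\<close>
  have "k \<le> length es \<Longrightarrow> m_reach G X Z (vs ! k) (0 < k \<and> es ! (k - 1) \<in> {Fwd, Bi})" for k
  proof (induction k)
    case 0
    then show ?case using is_walk_nth(1)[OF assms(1)] assms(3) by (simp add: m_reach.start)
  next
    case (Suc k)
    have "has_edge G (vs ! k) (es ! k) (vs ! Suc k)"
      using assms(1) Suc.prems by (simp add: is_walk_def)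
    moreover have "if (0 < k \<and> es ! (k - 1) \<in> {Fwd, Bi}) \<and> es ! k \<in> {Bwd, Bi}
        then vs ! k \<in> (\<Union>z\<in>Z. an G z) else vs ! k \<notin> Z"
    proof (cases "k = 0")
      case True
      then show ?thesis using is_walk_nth(1)[OF assms(1)] assms(4) by simp
    next
      case False
      then have "collider es k \<longleftrightarrow> (0 < k \<and> es ! (k - 1) \<in> {Fwd, Bi}) \<and> es ! k \<in> {Bwd, Bi}"
        by (simp add: collider_def)
      then show ?thesis using m_connecting_nth[OF assms(2), of k] False Suc.prems
        by (metis Suc_le_lessD bot_nat_0.not_eq_extremum)
    qed
    ultimately have "m_reach G X Z (vs ! Suc k) (es ! k \<in> {Fwd, Bi})"
      using m_reach.step[OF Suc.IH] Suc.prems by (meson Suc_leD)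
    then show ?case by simp
  qed
  from this[of "length es"] show ?thesis using is_walk_nth(2)[OF assms(1)] by auto
qed

text \<open>The first edge after \<open>i\<close> that is not \<open>Fwd\<close> creates a collider which is a descendant of \<open>vs ! i\<close>.\<close>

lemma m_connecting_loop_ancestor:
  assumes w: "is_walk G x vs es y" and c: "m_connecting G vs es Z"
    and ij: "i < j" "j \<le> length es" and e: "es ! i = Fwd" "es ! (j - 1) = Bwd"
  shows "vs ! i \<in> (\<Union>z\<in>Z. an G z)"
proof (rule ccontr)
  assume n: "vs ! i \<notin> (\<Union>z\<in>Z. an G z)"
  \<comment> \<open>Without such an ancestor every edge from \<open>i\<close> to
    \<open>j - 1\<close> is \<open>Fwd\<close>, contradicting
    \<open>es ! (j - 1) = Bwd\<close>.\<close>
  have "i + Suc k \<le> j \<Longrightarrow> (vs ! i, vs ! (i + Suc k)) \<in> (dir G)\<^sup>* \<and> es ! (i + k) = Fwd" for k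
  proof (induction k)
    case 0
    have "has_edge G (vs ! i) (es ! i) (vs ! Suc i)" using w ij by (simp add: is_walk_def)
    then show ?case using e by auto
  next
    case (Suc k)
    let ?m = "i + Suc k"
    have IH: "(vs ! i, vs ! ?m) \<in> (dir G)\<^sup>*" "es ! (i + k) = Fwd" using Suc by auto
    have m: "0 < ?m" "?m < length es" using Suc.prems ij by auto
    have "es ! ?m = Fwd"
    proof (rule ccontr)
      assume "es ! ?m \<noteq> Fwd"
      then have "collider es ?m" using IH(2) by (cases "es ! ?m") (auto simp: collider_def)
      then obtain z where "z \<in> Z" "vs ! ?m \<in> an G z"
        using m_connecting_nth[OF c m] by (metis UN_E)
      then show False using n IH(1) by (auto simp: an_def intro: rtrancl_trans)
    qed
    moreover have "has_edge G (vs ! ?m) (es ! ?m) (vs ! Suc ?m)" using w m by (simp add: is_walk_def)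
    ultimately show ?case using IH(1) by (auto intro: rtrancl.rtrancl_into_rtrancl)
  qed
  from this[of "j - 1 - i"] show False using ij e by auto
qed

text \<open>Only the vertex at the junction changes its neighbouring edges. If it is a collider
  after the cut but was one at neither \<open>i\<close> nor \<open>j\<close>, the loop leaves it by
  \<open>Fwd\<close> and returns by \<open>Bwd\<close>, so \<open>m_connecting_loop_ancestor\<close>
  applies. If it is a non-collider after the cut, it was one at \<open>i\<close> or at
  \<open>j\<close>.\<close>

lemma m_connecting_cut:
  assumes w: "is_walk G x vs es y" and c: "m_connecting G vs es Z"
    and ij: "i < j" "j \<le> length es" and eq: "vs ! i = vs ! j"
  shows "is_walk G x (take i vs @ drop j vs) (take i es @ drop j es) y"
    "m_connecting G (take i vs @ drop j vs) (take i es @ drop j es) Z"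
proof -
  let ?vs = "take i vs @ drop j vs" and ?es = "take i es @ drop j es"
  have len: "length vs = Suc (length es)" using w by (simp add: is_walk_def)
  have es1: "k < i \<Longrightarrow> ?es ! k = es ! k" for k using ij len by (simp add: nth_append)
  have es2: "i \<le> k \<Longrightarrow> k < length ?es \<Longrightarrow> ?es ! k = es ! (k + (j - i))" for k
    using ij len by (auto simp: nth_append intro!: arg_cong[of _ _ "(!) es"])
  \<comment> \<open>Valid at \<open>k = i\<close> too, where the entry comes from
    \<open>drop j vs\<close>, because \<open>vs ! i = vs ! j\<close>.\<close>
  have vs1: "k \<le> i \<Longrightarrow> ?vs ! k = vs ! k" for k
    using ij len eq by (auto simp: nth_append not_less)
  have vs2: "i \<le> k \<Longrightarrow> k \<le> length ?es \<Longrightarrow> ?vs ! k = vs ! (k + (j - i))" for k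
    using ij len by (auto simp: nth_append intro!: arg_cong[of _ _ "(!) vs"])
  have lens: "length ?es = length es - (j - i)" "length ?vs = Suc (length ?es)" using ij len by auto
  have vx: "vs ! 0 = x" "vs ! length es = y" using is_walk_nth[OF w] by auto
  show "is_walk G x ?vs ?es y"
    unfolding is_walk_def
  proof (intro conjI allI impI)
    show "set ?vs \<subseteq> verts G"
      using w set_take_subset[of i vs] set_drop_subset[of j vs] by (auto simp: is_walk_def)
    have "?vs \<noteq> []" using lens by auto
    then show "hd ?vs = x" "last ?vs = y"
      using vs1[of 0] vs2[of "length ?es"] lens ij vx
      by (auto simp: hd_conv_nth last_conv_nth simp del: length_append)
    fix k assume k: "k < length ?es"
    have "k < length es" "i \<le> k \<Longrightarrow> k + (j - i) < length es" using k lens ij by auto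
    then have ed: "has_edge G (vs ! k) (es ! k) (vs ! Suc k)"
      "i \<le> k \<Longrightarrow> has_edge G (vs ! (k + (j - i))) (es ! (k + (j - i))) (vs ! Suc (k + (j - i)))"
      using w by (auto simp: is_walk_def)
    show "has_edge G (?vs ! k) (?es ! k) (?vs ! Suc k)"
    proof (cases "k < i")
      case True
      then show ?thesis using ed(1) vs1[of k] vs1[of "Suc k"] es1 by simp
    next
      case False
      then show ?thesis using ed(2) vs2[of k] vs2[of "Suc k"] es2[of k] k by simp
    qed
  qed (use lens in simp)
  show "m_connecting G ?vs ?es Z"
    unfolding m_connecting_def
  proof (intro allI impI, elim conjE)
    fix k assume k: "0 < k" "k < length ?es"
    note cc = m_connecting_nth[OF c]
    consider "k < i" | "k = i" | "i < k" by linarith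
    then show "if collider ?es k then ?vs ! k \<in> (\<Union>z\<in>Z. an G z) else ?vs ! k \<notin> Z"
    proof cases
      case 1
      then have "collider ?es k = collider es k" using es1[of k] es1[of "k - 1"] by (simp add: collider_def)
      moreover have "k < length es" using 1 ij by simp
      ultimately show ?thesis using cc[of k] 1 k vs1[of k] by (metis less_imp_le)
    next
      case 3
      then have "collider ?es k = collider es (k + (j - i))"
        using es2[of k] es2[of "k - 1"] k by (simp add: collider_def)
      then show ?thesis 
        using cc[of "k + (j - i)"] 3 k vs2[of k] lens ij by (metis add_gr_0 less_diff_conv less_imp_le)
    next
      case 2
      have i0: "0 < i" and jl: "j < length es" using k 2 lens ij by auto
      have col: "collider ?es k \<longleftrightarrow> es ! (i - 1) \<in> {Fwd, Bi} \<and> es ! j \<in> {Bwd, Bi}"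
        using es1[of "i - 1"] es2[of i] i0 k 2 ij by (simp add: collider_def)
      have v: "?vs ! k = vs ! i" using vs1[of k] 2 by simp
      have ci: "if collider es i then vs ! i \<in> (\<Union>z\<in>Z. an G z) else vs ! i \<notin> Z"
        and cj: "if collider es j then vs ! i \<in> (\<Union>z\<in>Z. an G z) else vs ! i \<notin> Z"
        using cc[of i] cc[of j] i0 jl ij eq by auto
      show ?thesis
      proof (cases "collider ?es k")
        case True
        have "vs ! i \<in> (\<Union>z\<in>Z. an G z)"
        proof (cases "collider es i \<or> collider es j")
          case True
          then show ?thesis using ci cj by (auto split: if_splits)
        next
          case False
          then have "es ! i = Fwd" "es ! (j - 1) = Bwd"
            using True col by (cases "es ! i"; cases "es ! (j - 1)"; auto simp: collider_def)+
          then show ?thesis using m_connecting_loop_ancestor[OF w c ij] by simp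
        qed
        then show ?thesis using True v by simp
      next
        case False
        then have "\<not> collider es i \<or> \<not> collider es j" using col by (auto simp: collider_def)
        then have "vs ! i \<notin> Z" using ci cj by auto
        then show ?thesis using False v by simp
      qed
    qed
  qed
qed

lemma m_connecting_walk_imp_path:
  assumes "is_walk G x vs es y" "m_connecting G vs es Z"
  shows "\<exists>vs es. is_path G x vs es y \<and> m_connecting G vs es Z"
  using assms
proof (induction "length es" arbitrary: vs es rule: less_induct)
  case less
  show ?case
  proof (cases "distinct vs")
    case True
    then show ?thesis using less.prems by (auto simp: is_path_iff_walk)
  next
    case False
    have "length vs = Suc (length es)" using less.prems(1) by (simp add: is_walk_def)
    then obtain i j where ij: "i < j" "j \<le> length es" "vs ! i = vs ! j"
      using False unfolding distinct_conv_nth by (metis less_Suc_eq_le linorder_neqE_nat)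
    have "length (take i es @ drop j es) < length es" using ij by auto
    from less.hyps[OF this m_connecting_cut[OF less.prems ij]] show ?thesis .
  qed
qed

text \<open>Lets separation be argued by rule induction instead of on lists of vertices and
  edges.\<close>

lemma m_separated_iff_m_reach:
  assumes "admg G" "X \<subseteq> verts G" "disjnt X Z"
  shows "m_separated G X Y Z \<longleftrightarrow> \<not> (\<exists>y\<in>Y. \<exists>h. m_reach G X Z y h)"
proof
  assume s: "m_separated G X Y Z"
  show "\<not> (\<exists>y\<in>Y. \<exists>h. m_reach G X Z y h)"
    using m_reach_imp_walk[OF assms(1,2)] m_connecting_walk_imp_path s
    unfolding m_separated_def by metis
next
  assume "\<not> (\<exists>y\<in>Y. \<exists>h. m_reach G X Z y h)"
  then show "m_separated G X Y Z"
    using walk_imp_m_reach[of G _ _ _ _ Z X] assms(3)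
    unfolding m_separated_def is_path_iff_walk disjnt_iff by blast
qed

section \<open>Mixed directed cycles and separation by the parents\<close>

text \<open>A step to a vertex already on the path truncates the path there; any other step is
  appended.\<close>

lemma mixed_walk_imp_path:
  assumes "admg G" "a \<in> verts G" "(a, b) \<in> (dir G \<union> bidir G)\<^sup>*"
  shows "\<exists>vs es. is_path G a vs es b \<and> set es \<subseteq> {Fwd, Bi}"
  using assms(3)
proof induction
  case base
  then show ?case using assms(2) by (intro exI[of _ "[a]"] exI[of _ "[]"]) (simp add: is_path_def)
next
  case (step b c)
  then obtain vs es where p: "is_path G a vs es b" and es: "set es \<subseteq> {Fwd, Bi}" by blast
  have len: "length vs = Suc (length es)" using p by (simp add: is_path_def)
  have b: "vs ! length es = b"
    using p is_walk_nth(2) by (auto simp: is_path_iff_walk)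
  show ?case
  proof (cases "c \<in> set vs")
    case True
    then obtain i where i: "i \<le> length es" "vs ! i = c" by (metis in_set_conv_nth len less_Suc_eq_le)
    have "last (take (Suc i) vs) = c" using i len by (simp add: take_Suc_conv_app_nth)
    then have "is_path G a (take (Suc i) vs) (take i es) c"
      using p i len set_take_subset[of "Suc i" vs] unfolding is_path_def by auto
    then show ?thesis using es set_take_subset[of i es] by blast
  next
    case False
    from step.hyps(2) obtain e where e: "has_edge G b e c" "e \<in> {Fwd, Bi}"
      by (metis Un_iff has_edge.simps(1,3) insertCI)
    have "is_path G a (vs @ [c]) (es @ [e]) c"
      using p False e has_edge_verts[OF assms(1) e(1)] b
      unfolding is_path_def by (auto simp: nth_append less_Suc_eq hd_append)
    then show ?thesis using es e(2) by (intro exI[of _ "vs @ [c]"] exI[of _ "es @ [e]"]) auto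
  qed
qed

text \<open>The edge \<open>a \<rightarrow> b\<close> closes a mixed return path to a mixed directed
  cycle, except that a purely bi-directed return path contains no \<open>Fwd\<close> and has to be
  rotated first.\<close>

lemma no_mixed_directed_cycle_dir:
  assumes "admg G" "\<not> has_mixed_directed_cycle G" "(a, b) \<in> dir G"
  shows "(b, a) \<notin> (dir G \<union> bidir G)\<^sup>*"
proof
  assume r: "(b, a) \<in> (dir G \<union> bidir G)\<^sup>*"
  have ab: "a \<in> verts G" "b \<in> verts G" using assms by (auto simp: admg_def)
  from mixed_walk_imp_path[OF assms(1) ab(2) r] obtain vs es
    where p: "is_path G b vs es a" and es: "set es \<subseteq> {Fwd, Bi}" by blast
  have len: "length vs = Suc (length es)" and ed: "\<And>i. i < length es \<Longrightarrow> has_edge G (vs ! i) (es ! i) (vs ! Suc i)"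
    using p by (auto simp: is_path_def)
  have nth: "vs ! 0 = b" "vs ! length es = a" using p by (auto simp: is_path_iff_walk is_walk_nth)
  show False
  proof (cases "Fwd \<in> set es")
    case True
    then have "mixed_directed_path G b vs es a" using p es by (simp add: mixed_directed_path_def)
    then show False using assms(2,3) unfolding has_mixed_directed_cycle_def by blast
  next
    case False
    have "es \<noteq> []"
    proof
      assume "es = []"
      then have "a = b" using nth by simp
      then show False using assms(1,3) by (auto simp: admg_def acyclic_def)
    qed
    then obtain n where n: "length es = Suc n" by (cases es) auto
    have Bi: "i < length es \<Longrightarrow> es ! i = Bi" for i using es False nth_mem[of i es]
      by (metis empty_iff insert_iff subsetD)
    \<comment> \<open>Rotated cycle: start with \<open>a \<rightarrow> b\<close>, follow the return
      path to its last vertex before \<open>a\<close>, and close with the remaining bi-directed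
      edge.\<close>
    let ?us = "a # butlast vs" and ?fs = "Fwd # butlast es"
    have "vs \<noteq> []" "last vs = a" using p len by (auto simp: is_path_def)
    then have "vs = butlast vs @ [a]" by (metis append_butlast_last_id)
    then have "distinct (butlast vs @ [a])" using p by (simp add: is_path_def)
    then have "distinct ?us" by simp
    moreover have "has_edge G (?us ! i) (?fs ! i) (?us ! Suc i)" if "i < length ?fs" for i
    proof (cases i)
      case 0
      then show ?thesis using assms(3) nth(1) n len by (simp add: nth_butlast)
    next
      case (Suc k)
      then show ?thesis using ed[of k] that n len by (simp add: nth_butlast)
    qed
    moreover have "last ?us = vs ! n"
      using n len by (cases "butlast vs = []") (auto simp: last_conv_nth nth_butlast dest: arg_cong[of _ _ length])
    moreover have "set ?us \<subseteq> verts G" using p ab by (auto simp: is_path_def dest: in_set_butlastD)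
    ultimately have "is_path G a ?us ?fs (vs ! n)"
      using n len unfolding is_path_def by auto
    then have "mixed_directed_path G a ?us ?fs (vs ! n)"
      using es by (auto simp: mixed_directed_path_def dest: in_set_butlastD)
    moreover have "(vs ! n, a) \<in> bidir G" using ed[of n] n Bi[of n] nth(2) by simp
    ultimately show False using assms(2) unfolding has_mixed_directed_cycle_def by blast
  qed
qed

lemma m_separated_parents:
  assumes "admg G" "\<not> has_mixed_directed_cycle G" "x \<in> verts G"
  shows "m_separated G {x} (verts G - fam x G) (pa G x)"
proof -
  note nc = no_mixed_directed_cycle_dir[OF assms(1,2)]
  \<comment> \<open>Invariant: the walk is at a parent entered by a tail, where it is blocked; at
    \<open>x\<close>, not entered by an arrowhead; or at a descendant of \<open>x\<close> or of a
    spouse, entered by an arrowhead.\<close>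
  have "(v \<in> pa G x \<and> \<not> h) \<or> (v = x \<and> \<not> h) \<or> (h \<and> v \<in> (\<Union>w\<in>{x} \<union> sp G x. de G w))"
    if "m_reach G {x} (pa G x) v h" for v h
    using that
  proof induction
    case (step v h e w)
    \<comment> \<open>Such a vertex is never an open collider, so it can only be left by
      \<open>Fwd\<close>. Otherwise \<open>x\<close> would reach one of its parents along mixed
      edges, against \<open>nc\<close>.\<close>
    have "v \<notin> (\<Union>z\<in>pa G x. an G z)" if v: "v \<in> (\<Union>w\<in>{x} \<union> sp G x. de G w)"
    proof
      assume "v \<in> (\<Union>z\<in>pa G x. an G z)"
      then obtain p where p: "(p, x) \<in> dir G" "(v, p) \<in> (dir G)\<^sup>*" by (auto simp: pa_def an_def)
      from v obtain s where s: "s = x \<or> (x, s) \<in> bidir G" "(s, v) \<in> (dir G)\<^sup>*"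
        using assms(1) by (auto simp: sp_def de_def admg_def dest: symD)
      have "(s, p) \<in> (dir G \<union> bidir G)\<^sup>*"
        using s(2) p(2) rtrancl_mono[of "dir G" "dir G \<union> bidir G"] by (meson Un_upper1 rtrancl_trans subsetD)
      then have "(x, p) \<in> (dir G \<union> bidir G)\<^sup>*"
        using s(1) by (auto intro: converse_rtrancl_into_rtrancl)
      then show False using nc[OF p(1)] by simp
    qed
    then show ?case using step assms(1)
      by (cases e) (auto simp: pa_def sp_def de_def admg_def dest: symD split: if_splits
          intro: rtrancl.rtrancl_into_rtrancl)
  qed auto
  then have "v \<in> fam x G \<or> v = x" if "m_reach G {x} (pa G x) v h" for v h
    using that by (auto simp: fam_def)
  moreover have "x \<in> fam x G" by (auto simp: fam_def de_def)
  ultimately have "\<not> (\<exists>y\<in>verts G - fam x G. \<exists>h. m_reach G {x} (pa G x) y h)" by blast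
  moreover have "disjnt {x} (pa G x)" using assms(1) by (auto simp: pa_def admg_def acyclic_def)
  ultimately show ?thesis using m_separated_iff_m_reach[OF assms(1)] assms(3) by simp
qed

section \<open>Semigraphoid properties of conditional independence\<close>

lemma restrict_measurable_joint:
  assumes "joint_distribution V M P" "A \<subseteq> V"
  shows "(\<lambda>\<omega>. restrict \<omega> A) \<in> measurable P (PiM A M)"
  using measurable_restrict_subset[OF assms(2), of M] assms(1)
  by (simp add: joint_distribution_def cong: measurable_cong_sets)

lemma space_sigma_vars [simp]: "space (sigma_vars M P A) = space P"
  by (simp add: sigma_vars_def)

lemma restrict_measurable_sigma_vars:
  assumes "joint_distribution V M P" "A \<subseteq> V"
  shows "(\<lambda>\<omega>. restrict \<omega> A) \<in> measurable (sigma_vars M P A) (PiM A M)"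
  unfolding sigma_vars_def
  by (rule measurable_vimage_algebra1) (use restrict_measurable_joint[OF assms] in \<open>auto dest: measurable_space\<close>)

lemma subalgebra_sigma_vars:
  assumes "joint_distribution V M P" "A \<subseteq> V"
  shows "subalgebra P (sigma_vars M P A)"
proof -
  have "sets (sigma_vars M P A) \<subseteq> sets P"
    unfolding sigma_vars_def
    by (rule sets_image_in_sets'[OF sets.top]) (rule measurable_sets[OF restrict_measurable_joint[OF assms]])
  then show ?thesis by (simp add: subalgebra_def)
qed

text \<open>Restriction to \<open>A\<close> is measurable as soon as its coordinates are, so
  inclusions between these sigma-algebras can be checked coordinatewise.\<close>

lemma sets_sigma_vars_subsetI:
  assumes "space N = space P"
    and "\<And>i. i \<in> A \<Longrightarrow> (\<lambda>\<omega>. \<omega> i) \<in> measurable N (M i)"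
  shows "sets (sigma_vars M P A) \<subseteq> sets N"
proof -
  have "(\<lambda>\<omega>. restrict \<omega> A) \<in> measurable N (PiM A M)"
    using assms(2) by (rule measurable_restrict)
  from measurable_sets[OF this] show ?thesis
    unfolding sigma_vars_def assms(1)[symmetric] by (rule sets_image_in_sets'[OF sets.top])
qed

lemma component_measurable_sigma_vars:
  assumes "joint_distribution V M P" "A \<subseteq> V" "i \<in> A"
  shows "(\<lambda>\<omega>. \<omega> i) \<in> measurable (sigma_vars M P A) (M i)"
  using measurable_compose[OF restrict_measurable_sigma_vars[OF assms(1,2)] measurable_component_singleton[OF assms(3)]]
    assms(3) by simp

lemma sets_sigma_vars_mono:
  assumes "joint_distribution V M P" "A \<subseteq> B" "B \<subseteq> V"
  shows "sets (sigma_vars M P A) \<subseteq> sets (sigma_vars M P B)"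
  by (rule sets_sigma_vars_subsetI) (use component_measurable_sigma_vars[OF assms(1,3)] assms(2) in auto)

lemma subalgebra_sigma_vars_mono:
  assumes "joint_distribution V M P" "A \<subseteq> B" "B \<subseteq> V"
  shows "subalgebra (sigma_vars M P B) (sigma_vars M P A)"
  using sets_sigma_vars_mono[OF assms] by (simp add: subalgebra_def)

text \<open>A pi-system generating the sigma-algebra of \<open>A \<union> B\<close>, on which
  integral identities can be tested.\<close>

definition rects :: "('v \<Rightarrow> 'a measure) \<Rightarrow> ('v \<Rightarrow> 'a) measure \<Rightarrow> 'v set \<Rightarrow> 'v set \<Rightarrow> ('v \<Rightarrow> 'a) set set" where
  "rects M P A B = {S \<inter> T | S T. S \<in> sets (sigma_vars M P A) \<and> T \<in> sets (sigma_vars M P B)}"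

lemma rectsI: "S \<in> sets (sigma_vars M P A) \<Longrightarrow> T \<in> sets (sigma_vars M P B) \<Longrightarrow> S \<inter> T \<in> rects M P A B"
  by (auto simp: rects_def)

lemma sigma_vars_subset_rects:
  shows "sets (sigma_vars M P A) \<subseteq> rects M P A B" "sets (sigma_vars M P B) \<subseteq> rects M P A B"
proof safe
  fix S assume S: "S \<in> sets (sigma_vars M P A)"
  have "S = S \<inter> space P" using sets.sets_into_space[OF S] by auto
  then show "S \<in> rects M P A B" using rectsI[OF S sets.top[of "sigma_vars M P B"]] by simp
next
  fix S assume S: "S \<in> sets (sigma_vars M P B)"
  have "S = space P \<inter> S" using sets.sets_into_space[OF S] by auto
  then show "S \<in> rects M P A B" using rectsI[OF sets.top[of "sigma_vars M P A"] S] by simp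
qed

lemma Int_stable_rects: "Int_stable (rects M P A B)"
proof (rule Int_stableI)
  fix C D assume "C \<in> rects M P A B" "D \<in> rects M P A B"
  then obtain S T S' T' where
    "C = S \<inter> T" "S \<in> sets (sigma_vars M P A)" "T \<in> sets (sigma_vars M P B)"
    "D = S' \<inter> T'" "S' \<in> sets (sigma_vars M P A)" "T' \<in> sets (sigma_vars M P B)"
    by (auto simp: rects_def)
  moreover have "(S \<inter> T) \<inter> (S' \<inter> T') = (S \<inter> S') \<inter> (T \<inter> T')" by blast
  ultimately show "C \<inter> D \<in> rects M P A B"
    using rectsI[of "S \<inter> S'" M P A "T \<inter> T'" B] by simp
qed

lemma rects_Pow: "rects M P A B \<subseteq> Pow (space P)"
  using sets.sets_into_space[of _ "sigma_vars M P A"] by (fastforce simp: rects_def)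

lemma sets_sigma_vars_Un:
  assumes "joint_distribution V M P" "A \<subseteq> V" "B \<subseteq> V"
  shows "sets (sigma_vars M P (A \<union> B)) = sigma_sets (space P) (rects M P A B)"
proof
  let ?N = "sigma (space P) (rects M P A B)"
  have sN: "sets ?N = sigma_sets (space P) (rects M P A B)" "space ?N = space P"
    by (simp_all add: rects_Pow)
  have "sets (sigma_vars M P A) \<subseteq> sets ?N" "sets (sigma_vars M P B) \<subseteq> sets ?N"
    unfolding sN using sigma_vars_subset_rects[where M=M and P=P] by (blast intro: sigma_sets.Basic)+
  then have "(\<lambda>\<omega>. \<omega> i) \<in> measurable ?N (M i)" if "i \<in> A \<union> B" for i
    using that component_measurable_sigma_vars[OF assms(1,2), of i] component_measurable_sigma_vars[OF assms(1,3), of i] sN(2)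
    unfolding measurable_def by fastforce
  then show "sets (sigma_vars M P (A \<union> B)) \<subseteq> sigma_sets (space P) (rects M P A B)"
    using sets_sigma_vars_subsetI[of ?N P "A \<union> B" M] sN by simp
  have AB: "A \<union> B \<subseteq> V" using assms by auto
  have "rects M P A B \<subseteq> sets (sigma_vars M P (A \<union> B))"
    using sets_sigma_vars_mono[OF assms(1) _ AB, of A] sets_sigma_vars_mono[OF assms(1) _ AB, of B]
    by (auto simp: rects_def)
  then show "sigma_sets (space P) (rects M P A B) \<subseteq> sets (sigma_vars M P (A \<union> B))"
    using sets.sigma_sets_subset[of "rects M P A B" "sigma_vars M P (A \<union> B)"] by simp
qed

text \<open>Pi-lambda argument: \<open>space M \<in> E\<close> supplies the total integral for
  complements, and integrability of \<open>f\<close> gives countable additivity over disjoint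
  unions.\<close>

lemma set_integral_eq_0_sigma_sets:
  fixes f :: "'a \<Rightarrow> real"
  assumes f: "integrable M f" and E: "Int_stable E" "E \<subseteq> sets M" "space M \<in> E"
    and z: "\<And>S. S \<in> E \<Longrightarrow> (\<integral>x\<in>S. f x \<partial>M) = 0"
    and S: "S \<in> sigma_sets (space M) E"
  shows "(\<integral>x\<in>S. f x \<partial>M) = 0"
proof -
  have Pow: "E \<subseteq> Pow (space M)" using E(2) sets.sets_into_space by auto
  have sub: "sigma_sets (space M) E \<subseteq> sets M" using E(2) by (rule sets.sigma_sets_subset)
  have si: "T \<in> sets M \<Longrightarrow> set_integrable M T f" for T
    using integrable_mult_indicator[OF _ f] by (simp add: set_integrable_def)
  show ?thesis using E(1) Pow S
  proof (induction rule: sigma_sets_induct_disjoint)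
    case (compl T)
    then have T: "T \<in> sets M" using sub by auto
    have "(\<integral>x\<in>space M. f x \<partial>M) = (\<integral>x\<in>T \<union> (space M - T). f x \<partial>M)"
      using sets.sets_into_space[OF T] by (simp add: Un_absorb1)
    also have "\<dots> = (\<integral>x\<in>T. f x \<partial>M) + (\<integral>x\<in>space M - T. f x \<partial>M)"
      using T by (intro set_integral_Un si) auto
    finally show ?case using compl z[OF E(3)] by simp
  next
    case (union A)
    have "A i \<in> sets M" for i using union sub by auto
    then have "(\<integral>x\<in>(\<Union>i. A i). f x \<partial>M) = (\<Sum>i. \<integral>x\<in>A i. f x \<partial>M)"
      using union.hyps(1) by (intro lebesgue_integral_countable_add si)
        (auto simp: disjoint_family_on_def)
    then show ?case using union by simp
  qed (use z in \<open>auto simp: set_lebesgue_integral_def\<close>)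
qed

text \<open>With the product replaced by the statement that \<open>Y\<close> adds no information
  about \<open>X\<close> beyond \<open>Z\<close>, weak union and contraction become chains of almost
  sure equalities.\<close>

lemma cond_indep_iff:
  assumes J: "joint_distribution V M P" and V: "X \<subseteq> V" "Y \<subseteq> V" "Z \<subseteq> V"
  shows "cond_indep M P X Z Y \<longleftrightarrow>
    (\<forall>A\<in>sets (sigma_vars M P X). AE \<omega> in P.
       real_cond_exp P (sigma_vars M P (Z \<union> Y)) (indicator A) \<omega> =
       real_cond_exp P (sigma_vars M P Z) (indicator A) \<omega>)"
    (is "_ \<longleftrightarrow> ?R")
proof -
  interpret prob_space P using J by (simp add: joint_distribution_def)
  have ZY: "Z \<union> Y \<subseteq> V" using V by auto
  have sX: "subalgebra P (sigma_vars M P X)" and sY: "subalgebra P (sigma_vars M P Y)"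
    and sZ: "subalgebra P (sigma_vars M P Z)" and sZY: "subalgebra P (sigma_vars M P (Z \<union> Y))"
    and sZZY: "subalgebra (sigma_vars M P (Z \<union> Y)) (sigma_vars M P Z)"
    using subalgebra_sigma_vars[OF J] subalgebra_sigma_vars_mono[OF J _ ZY] V ZY by auto
  interpret Z: finite_measure_subalgebra P "sigma_vars M P Z" by unfold_locales (rule sZ)
  interpret ZY: finite_measure_subalgebra P "sigma_vars M P (Z \<union> Y)" by unfold_locales (rule sZY)
  let ?EZ = "real_cond_exp P (sigma_vars M P Z)" and ?EZY = "real_cond_exp P (sigma_vars M P (Z \<union> Y))"
  have YP: "\<And>B. B \<in> sets (sigma_vars M P Y) \<Longrightarrow> B \<in> sets P" and XP: "\<And>B. B \<in> sets (sigma_vars M P X) \<Longrightarrow> B \<in> sets P"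
    and ZP: "\<And>B. B \<in> sets (sigma_vars M P Z) \<Longrightarrow> B \<in> sets P"
    using sX sY sZ by (auto simp: subalgebra_def)
  have int: "integrable P (indicator B :: _ \<Rightarrow> real)" if "B \<in> sets P" for B
    using that by (simp add: emeasure_eq_measure)
  have intmult: "integrable P (\<lambda>x. indicator B x * g x)" if "B \<in> sets P" "integrable P g" for B and g :: "_ \<Rightarrow> real"
    using integrable_mult_indicator[OF that] by simp
  have EZ_meas: "?EZ f \<in> borel_measurable P" "?EZ f \<in> borel_measurable (sigma_vars M P Z)"
    "?EZ f \<in> borel_measurable (sigma_vars M P (Z \<union> Y))" for f
    by (simp_all add: measurable_from_subalg[OF sZZY])
  \<comment> \<open>Taking out the factor measurable with respect to \<open>Z\<close> turns the
    product in \<open>cond_indep\<close> into a single conditional expectation.\<close>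
  have pull: "AE \<omega> in P. ?EZ (\<lambda>\<omega>. indicator B \<omega> * ?EZ (indicator A) \<omega>) \<omega> = ?EZ (indicator A) \<omega> * ?EZ (indicator B) \<omega>"
    if "A \<in> sets P" "B \<in> sets P" for A B
  proof -
    have "integrable P (\<lambda>\<omega>. ?EZ (indicator A) \<omega> * indicator B \<omega>)"
      using intmult[OF that(2) Z.real_cond_exp_int(1)[OF int[OF that(1)]]] by (simp add: mult.commute)
    from Z.real_cond_exp_mult[OF _ _ this] that(2) show ?thesis
      by (simp add: mult.commute)
  qed
  show ?thesis
  proof
    assume ci: "cond_indep M P X Z Y"
    show ?R
    proof
      fix A assume A: "A \<in> sets (sigma_vars M P X)"
      note AP = XP[OF A]
      have iEA: "integrable P (?EZ (indicator A))" using Z.real_cond_exp_int(1)[OF int[OF AP]] .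
      let ?d = "\<lambda>\<omega>. indicator A \<omega> - ?EZ (indicator A) \<omega>"
      have id: "integrable P ?d" using int[OF AP] iEA by simp
      \<comment> \<open>On \<open>C \<inter> B\<close> both terms of \<open>?d\<close> become
        integrals over \<open>C\<close> of functions whose conditional expectations given
        \<open>Z\<close> agree by \<open>pull\<close> and \<open>ci\<close>.\<close>
      have "(\<integral>\<omega>\<in>S. ?d \<omega> \<partial>P) = 0" if S: "S \<in> rects M P Z Y" for S
      proof -
        obtain C B where S: "S = C \<inter> B" "C \<in> sets (sigma_vars M P Z)" "B \<in> sets (sigma_vars M P Y)"
          using S by (auto simp: rects_def)
        note CP = ZP[OF S(2)] and BP = YP[OF S(3)]
        let ?g = "\<lambda>\<omega>. indicator B \<omega> * ?EZ (indicator A) \<omega>"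
        have ig: "integrable P ?g" using intmult[OF BP iEA] .
        have iAB: "integrable P (indicator (A \<inter> B) :: _ \<Rightarrow> real)" using AP BP by (intro int) auto
        have "(\<integral>\<omega>\<in>C. ?g \<omega> \<partial>P) = (\<integral>\<omega>\<in>C. ?EZ ?g \<omega> \<partial>P)"
          using Z.real_cond_exp_intA[OF ig S(2)] .
        also have "\<dots> = (\<integral>\<omega>\<in>C. ?EZ (indicator (A \<inter> B)) \<omega> \<partial>P)"
        proof (rule set_lebesgue_integral_cong_AE[OF CP])
          show "AE \<omega>\<in>C in P. ?EZ ?g \<omega> = ?EZ (indicator (A \<inter> B)) \<omega>"
            using pull[OF AP BP] ci[unfolded cond_indep_def, rule_format, OF A S(3)] by eventually_elim simp
        qed auto
        also have "\<dots> = (\<integral>\<omega>\<in>C. indicator (A \<inter> B) \<omega> \<partial>P)"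
          using Z.real_cond_exp_intA[OF iAB S(2)] by simp
        finally have *: "(\<integral>\<omega>\<in>C. ?g \<omega> \<partial>P) = (\<integral>\<omega>\<in>C. indicator (A \<inter> B) \<omega> \<partial>P)" .
        have "(\<integral>\<omega>\<in>S. ?d \<omega> \<partial>P) = (\<integral>\<omega>\<in>C. (indicator (A \<inter> B) \<omega> - ?g \<omega>) \<partial>P)"
          unfolding set_lebesgue_integral_def S(1)
          by (intro Bochner_Integration.integral_cong) (auto simp: indicator_def)
        also have "\<dots> = (\<integral>\<omega>\<in>C. indicator (A \<inter> B) \<omega> \<partial>P) - (\<integral>\<omega>\<in>C. ?g \<omega> \<partial>P)"
          using integrable_mult_indicator[OF CP iAB] integrable_mult_indicator[OF CP ig]
          by (intro set_integral_diff) (auto simp: set_integrable_def)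
        finally show ?thesis using * by simp
      qed
      moreover have "rects M P Z Y \<subseteq> sets P" using YP ZP by (auto simp: rects_def)
      moreover have "space P \<in> rects M P Z Y"
        using sets.top[of "sigma_vars M P Z"] sigma_vars_subset_rects(1)[of M P Z Y] by auto
      ultimately have d0: "(\<integral>\<omega>\<in>S. ?d \<omega> \<partial>P) = 0" if "S \<in> sets (sigma_vars M P (Z \<union> Y))" for S
        using set_integral_eq_0_sigma_sets[OF id Int_stable_rects[of M P Z Y]] that
        unfolding sets_sigma_vars_Un[OF J V(3,2)] by blast
      show "AE \<omega> in P. ?EZY (indicator A) \<omega> = ?EZ (indicator A) \<omega>"
      proof (rule ZY.real_cond_exp_charact)
        fix S assume S: "S \<in> sets (sigma_vars M P (Z \<union> Y))"
        then have SP: "S \<in> sets P" using sZY by (auto simp: subalgebra_def)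
        have "(\<integral>\<omega>\<in>S. ?d \<omega> \<partial>P) = (\<integral>\<omega>\<in>S. indicator A \<omega> \<partial>P) - (\<integral>\<omega>\<in>S. ?EZ (indicator A) \<omega> \<partial>P)"
          using integrable_mult_indicator[OF SP int[OF AP]] integrable_mult_indicator[OF SP iEA]
          by (intro set_integral_diff) (auto simp: set_integrable_def)
        then show "(\<integral>\<omega>\<in>S. indicator A \<omega> \<partial>P) = (\<integral>\<omega>\<in>S. ?EZ (indicator A) \<omega> \<partial>P)"
          using d0[OF S] by simp
      qed (use int[OF AP] iEA EZ_meas in auto)
    qed
  next
    assume R: ?R
    show "cond_indep M P X Z Y"
      unfolding cond_indep_def
    proof (intro ballI)
      fix A B assume A: "A \<in> sets (sigma_vars M P X)" and B: "B \<in> sets (sigma_vars M P Y)"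
      note AP = XP[OF A] and BP = YP[OF B]
      have B': "B \<in> sets (sigma_vars M P (Z \<union> Y))"
        using sets_sigma_vars_mono[OF J _ ZY, of Y] B by auto
      have iAB: "integrable P (\<lambda>\<omega>. indicator B \<omega> * indicator A \<omega> :: real)"
        using intmult[OF BP int[OF AP]] .
      have AB: "indicator (A \<inter> B) = (\<lambda>\<omega>. indicator B \<omega> * indicator A \<omega> :: real)"
        by (auto simp: indicator_def)
      \<comment> \<open>Tower property: condition on \<open>Z \<union> Y\<close> first, where
        \<open>B\<close> can be taken out, use \<open>R\<close> to replace
        \<open>?EZY (indicator A)\<close>, then condition down to \<open>Z\<close>.\<close>
      have "AE \<omega> in P. ?EZY (\<lambda>\<omega>. indicator B \<omega> * indicator A \<omega>) \<omega> = indicator B \<omega> * ?EZY (indicator A) \<omega>"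
        by (rule ZY.real_cond_exp_mult) (use B' AP iAB in auto)
      then have "AE \<omega> in P. ?EZY (indicator (A \<inter> B)) \<omega> = indicator B \<omega> * ?EZ (indicator A) \<omega>"
        using R[rule_format, OF A] unfolding AB by eventually_elim simp
      then have "AE \<omega> in P. ?EZ (?EZY (indicator (A \<inter> B))) \<omega> = ?EZ (\<lambda>\<omega>. indicator B \<omega> * ?EZ (indicator A) \<omega>) \<omega>"
        by (rule Z.real_cond_exp_cong) (use BP in auto)
      moreover have "AE \<omega> in P. ?EZ (?EZY (indicator (A \<inter> B))) \<omega> = ?EZ (indicator (A \<inter> B)) \<omega>"
        using iAB unfolding AB by (intro Z.real_cond_exp_nested_subalg sZY sZZY)
      ultimately show "AE \<omega> in P. ?EZ (indicator (A \<inter> B)) \<omega> = ?EZ (indicator A) \<omega> * ?EZ (indicator B) \<omega>"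
        using pull[OF AP BP] by eventually_elim simp
    qed
  qed
qed

section \<open>Semigraphoid rules and composition\<close>

lemma cond_indep_sym:
  assumes "cond_indep M P X Z Y"
  shows "cond_indep M P Y Z X"
  unfolding cond_indep_def
proof (intro ballI)
  fix A B assume A: "A \<in> sets (sigma_vars M P Y)" and B: "B \<in> sets (sigma_vars M P X)"
  from assms[unfolded cond_indep_def, rule_format, OF B A] show "AE \<omega> in P. real_cond_exp P (sigma_vars M P Z) (indicator (A \<inter> B)) \<omega> =
      real_cond_exp P (sigma_vars M P Z) (indicator A) \<omega> * real_cond_exp P (sigma_vars M P Z) (indicator B) \<omega>"
    by (simp add: Int_commute mult.commute)
qed

lemma cond_indep_mono:
  assumes "joint_distribution V M P" "X \<subseteq> V" "Y \<subseteq> V"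
    and "cond_indep M P X Z Y" "X' \<subseteq> X" "Y' \<subseteq> Y"
  shows "cond_indep M P X' Z Y'"
  using assms(4) sets_sigma_vars_mono[OF assms(1,5,2)] sets_sigma_vars_mono[OF assms(1,6,3)]
  unfolding cond_indep_def by blast

text \<open>Conditioning on \<open>Z \<union> W \<union> Y\<close> and on
  \<open>Z \<union> W\<close> both agree with conditioning on \<open>Z\<close>, hence with each
  other.\<close>

lemma cond_indep_weak_union:
  assumes J: "joint_distribution V M P" and V: "X \<subseteq> V" "Y \<subseteq> V" "Z \<subseteq> V" "W \<subseteq> V"
    and ci: "cond_indep M P X Z (Y \<union> W)"
  shows "cond_indep M P X (Z \<union> W) Y"
proof -
  have sub: "Z \<union> W \<subseteq> V" "Y \<union> W \<subseteq> V" using V by auto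
  have W: "cond_indep M P X Z W" using cond_indep_mono[OF J V(1) sub(2) ci] by auto
  have eq: "Z \<union> (Y \<union> W) = Z \<union> W \<union> Y" by auto
  show ?thesis
    unfolding cond_indep_iff[OF J V(1,2) sub(1)]
  proof
    fix A assume A: "A \<in> sets (sigma_vars M P X)"
    from ci[unfolded cond_indep_iff[OF J V(1) sub(2) V(3)] eq, rule_format, OF A]
      W[unfolded cond_indep_iff[OF J V(1,4,3)], rule_format, OF A]
    show "AE \<omega> in P. real_cond_exp P (sigma_vars M P (Z \<union> W \<union> Y)) (indicator A) \<omega> =
        real_cond_exp P (sigma_vars M P (Z \<union> W)) (indicator A) \<omega>"
      by eventually_elim simp
  qed
qed

text \<open>The two hypotheses drop first \<open>Y\<close> and then \<open>W\<close> from the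
  conditioning set.\<close>

lemma cond_indep_contraction:
  assumes J: "joint_distribution V M P" and V: "X \<subseteq> V" "Y \<subseteq> V" "Z \<subseteq> V" "W \<subseteq> V"
    and ci: "cond_indep M P X (Z \<union> W) Y" "cond_indep M P X Z W"
  shows "cond_indep M P X Z (Y \<union> W)"
proof -
  have sub: "Z \<union> W \<subseteq> V" "Y \<union> W \<subseteq> V" using V by auto
  have eq: "Z \<union> (Y \<union> W) = Z \<union> W \<union> Y" by auto
  show ?thesis
    unfolding cond_indep_iff[OF J V(1) sub(2) V(3)] eq
  proof
    fix A assume A: "A \<in> sets (sigma_vars M P X)"
    from ci(1)[unfolded cond_indep_iff[OF J V(1,2) sub(1)], rule_format, OF A]
      ci(2)[unfolded cond_indep_iff[OF J V(1,4,3)], rule_format, OF A]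
    show "AE \<omega> in P. real_cond_exp P (sigma_vars M P (Z \<union> W \<union> Y)) (indicator A) \<omega> =
        real_cond_exp P (sigma_vars M P Z) (indicator A) \<omega>"
      by eventually_elim simp
  qed
qed

lemma cond_indep_empty:
  assumes J: "joint_distribution V M P" and V: "X \<subseteq> V" "Z \<subseteq> V"
  shows "cond_indep M P X Z {}"
  using cond_indep_iff[OF J V(1) _ V(2), of "{}"] by simp

lemma cond_indep_Un_right:
  assumes "composition_axiom V M P" "X \<subseteq> V" "Y \<subseteq> V" "Z \<subseteq> V" "W \<subseteq> V"
    and "disjnt X Y" "disjnt X Z" "disjnt X W" "disjnt Y Z" "disjnt Y W" "disjnt Z W"
    and "cond_indep M P X Z Y" "cond_indep M P X Z W"
  shows "cond_indep M P X Z (Y \<union> W)"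
  using assms unfolding composition_axiom_def by blast

text \<open>Composition collects \<open>D\<close> vertex by vertex, after symmetry has moved it to
  the third argument.\<close>

lemma cond_indep_finite_left:
  assumes J: "joint_distribution V M P" and C: "composition_axiom V M P"
    and "finite D" "D \<subseteq> V" "Y \<subseteq> V" "Z \<subseteq> V" "disjnt D Y" "disjnt D Z" "disjnt Y Z"
    and "\<And>x. x \<in> D \<Longrightarrow> cond_indep M P {x} Z Y"
  shows "cond_indep M P D Z Y"
  using assms(3,4,7,8,10)
proof (induction D rule: finite_induct)
  case empty
  then show ?case using cond_indep_sym[OF cond_indep_empty[OF J assms(5,6)]] by simp
next
  case (insert x D)
  have "cond_indep M P Y Z ({x} \<union> D)"
    using insert assms(5,6,9)
    by (intro cond_indep_Un_right[OF C] cond_indep_sym[of _ _ "{x}"] cond_indep_sym[of _ _ D])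
      (auto simp: disjnt_iff)
  then show ?case using cond_indep_sym[of M P Y Z] by simp
qed

text \<open>One step of the construction: \<open>X \<union> Y \<union> Z\<close> is the set built so
  far, \<open>D\<close> the new district and \<open>Q\<close> its parents. As \<open>Q\<close>
  avoids \<open>Y\<close>, weak union makes \<open>D\<close> independent of \<open>Y\<close> given
  \<open>Z \<union> X\<close>; contraction joins \<open>D\<close> to \<open>X\<close>, and a second
  weak union moves \<open>D \<inter> U\<close> into the conditioning set.\<close>

lemma cond_indep_extend:
  assumes J: "joint_distribution V M P"
    and V: "D \<subseteq> V" "X \<subseteq> V" "Y \<subseteq> V" "Z \<subseteq> V" "Q \<subseteq> V"
    and ci: "cond_indep M P X Z Y" and D: "cond_indep M P D Q ((X \<union> Y \<union> Z) - Q)"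
    and Q: "Q \<subseteq> X \<union> Z" "disjnt X Y" "disjnt Y Z"
  shows "cond_indep M P (X \<union> (D - U)) (Z \<union> (D \<inter> U)) Y"
proof -
  have QY: "disjnt Q Y" using Q by (auto simp: disjnt_iff)
  have eq: "(X \<union> Y \<union> Z) - Q = Y \<union> ((X \<union> Z) - Q)" using QY by (auto simp: disjnt_iff)
  have "cond_indep M P D (Q \<union> ((X \<union> Z) - Q)) Y"
    by (rule cond_indep_weak_union[OF J]) (use V D eq in auto)
  moreover have "Q \<union> ((X \<union> Z) - Q) = Z \<union> X" using Q by auto
  ultimately have "cond_indep M P Y (Z \<union> X) D" using cond_indep_sym by metis
  then have "cond_indep M P Y Z (D \<union> X)"
    by (rule cond_indep_contraction[OF J V(3,1,4,2)]) (rule cond_indep_sym[OF ci])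
  moreover have "D \<union> X = (X \<union> (D - U)) \<union> (D \<inter> U)" by auto
  ultimately have "cond_indep M P Y Z ((X \<union> (D - U)) \<union> (D \<inter> U))" by simp
  then have "cond_indep M P Y (Z \<union> (D \<inter> U)) (X \<union> (D - U))"
    by (rule cond_indep_weak_union[OF J, rotated -1]) (use V in auto)
  then show ?thesis by (rule cond_indep_sym)
qed

section \<open>Districts of ancestral sets\<close>

definition ancestral :: "'v mixed_graph \<Rightarrow> 'v set \<Rightarrow> bool" where
  "ancestral G A \<longleftrightarrow> (\<forall>x\<in>A. pa G x \<subseteq> A)"

definition district :: "'v mixed_graph \<Rightarrow> 'v set \<Rightarrow> 'v \<Rightarrow> 'v set" where
  "district G A x = {y. (x, y) \<in> (bidir G \<inter> A \<times> A)\<^sup>*}"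

lemma ancestral_rtrancl:
  assumes "ancestral G A" "(v, w) \<in> (dir G)\<^sup>*" "w \<in> A"
  shows "v \<in> A"
  using assms(2,3)
  by (induction rule: converse_rtrancl_induct) (use assms(1) in \<open>auto simp: ancestral_def pa_def\<close>)

lemma district_subset: "x \<in> A \<Longrightarrow> district G A x \<subseteq> A"
  unfolding district_def by (auto elim: rtranclE)

lemma sp_district:
  assumes "admg G" "x \<in> district G A v" "s \<in> sp G x" "v \<in> A" "s \<in> A"
  shows "s \<in> district G A v"
proof -
  have "(x, s) \<in> bidir G \<inter> A \<times> A"
    using assms district_subset[OF assms(4)] by (auto simp: sp_def admg_def dest: symD)
  then show ?thesis using assms(2) by (auto simp: district_def intro: rtrancl.rtrancl_into_rtrancl)
qed

text \<open>A minimal vertex for the strict part of mixed reachability generates the required district.\<close>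

lemma ex_source_district:
  assumes "admg G" "\<not> has_mixed_directed_cycle G" "A \<subseteq> verts G" "ancestral G A"
    and "B \<subset> A" "\<And>x. x \<in> B \<Longrightarrow> sp G x \<inter> A \<subseteq> B"
  shows "\<exists>v\<in>A - B. district G A v \<subseteq> A - B \<and> (\<forall>x\<in>district G A v. pa G x \<subseteq> B)"
proof -
  let ?R = "(dir G \<union> bidir G)\<^sup>*"
  \<comment> \<open>Bi-directed edges can be followed both ways, so minimality is taken in the
    strict part of \<open>?R\<close>; it is transitive and irreflexive, hence well-founded on the
    finite set \<open>A - B\<close>.\<close>
  let ?S = "{(v, w). (v, w) \<in> ?R \<and> (w, v) \<notin> ?R}"
  have fin: "finite (A - B)" using assms(1,3) by (auto simp: admg_def intro: finite_subset)
  have "trans ?S" by (rule transI) (auto intro: rtrancl_trans)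
  then have "acyclic ?S" by (simp add: acyclic_irrefl irrefl_def)
  then have "acyclic (?S \<inter> (A - B) \<times> (A - B))" by (rule acyclic_subset) auto
  then have "wf (?S \<inter> (A - B) \<times> (A - B))" using fin by (intro finite_acyclic_wf) auto
  then obtain v where v: "v \<in> A - B" and min: "\<And>w. w \<in> A - B \<Longrightarrow> (w, v) \<notin> ?S"
    using assms(5) by (auto elim!: wfE_min'[of _ "A - B"])
  \<comment> \<open>No bi-directed edge within \<open>A\<close> crosses into \<open>B\<close>, so
    the whole district stays outside \<open>B\<close> and mutually reachable with
    \<open>v\<close>.\<close>
  have D: "y \<in> A - B \<and> (v, y) \<in> ?R \<and> (y, v) \<in> ?R" if "y \<in> district G A v" for y
    using that[unfolded district_def mem_Collect_eq]
  proof induction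
    case (step y z)
    have "z \<notin> B"
    proof
      assume "z \<in> B"
      then have "y \<in> B" using assms(6)[of z] step by (auto simp: sp_def)
      then show False using step by simp
    qed
    moreover have "(z, y) \<in> bidir G" using step assms(1) by (auto simp: admg_def dest: symD)
    ultimately show ?case using step
      by (auto intro: converse_rtrancl_into_rtrancl rtrancl.rtrancl_into_rtrancl)
  qed (use v in auto)
  \<comment> \<open>A parent \<open>p\<close> outside \<open>B\<close> reaches \<open>v\<close>, so
    minimality gives a way back from \<open>v\<close> to \<open>p\<close>, hence from
    \<open>x\<close> to \<open>p\<close>, against the edge \<open>p \<rightarrow> x\<close>.\<close>
  have "p \<in> B" if x: "x \<in> district G A v" and p: "p \<in> pa G x" for x p
  proof (rule ccontr)
    assume "p \<notin> B"
    moreover have "p \<in> A" using D[OF x] p assms(4) by (auto simp: ancestral_def)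
    moreover have px: "(p, x) \<in> dir G" using p by (simp add: pa_def)
    then have "(p, v) \<in> ?R" using D[OF x] by (auto intro: converse_rtrancl_into_rtrancl)
    ultimately have "(v, p) \<in> ?R" using min[of p] by auto
    then have "(x, p) \<in> ?R" using D[OF x] by (auto intro: rtrancl_trans)
    then show False using no_mixed_directed_cycle_dir[OF assms(1,2) px] by simp
  qed
  then show ?thesis using v D by blast
qed

text \<open>For a single \<open>x\<close> in the district, the local property covers all of
  \<open>B\<close> but the parents of \<open>x\<close>. Weak union adds the other vertices of
  \<open>Q\<close> to the conditioning set, so that all \<open>x\<close> share it and composition
  applies.\<close>

lemma cond_indep_district:
  assumes G: "admg G" and J: "joint_distribution (verts G) M P" and C: "composition_axiom (verts G) M P"
    and L: "local_markov G M P" and A: "A \<subseteq> verts G"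
    and B: "B \<subseteq> A" "ancestral G B" and v: "v \<in> A" "district G A v \<subseteq> A - B"
    and Q: "\<And>x. x \<in> district G A v \<Longrightarrow> pa G x \<subseteq> Q" "Q \<subseteq> B"
  shows "cond_indep M P (district G A v) Q (B - Q)"
proof (rule cond_indep_finite_left[OF J C])
  fix x assume x: "x \<in> district G A v"
  have xA: "x \<in> A" using x v by auto
  \<comment> \<open>A descendant of \<open>x\<close> or of a spouse lying in \<open>B\<close> would
    put \<open>x\<close> or that spouse into \<open>B\<close>, as \<open>B\<close> is ancestral,
    although it then belongs to the district.\<close>
  have "B \<inter> fam x G \<subseteq> pa G x"
  proof
    fix b assume b: "b \<in> B \<inter> fam x G"
    show "b \<in> pa G x"
    proof (rule ccontr)
      assume "b \<notin> pa G x"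
      then obtain s where s: "s = x \<or> s \<in> sp G x" "(s, b) \<in> (dir G)\<^sup>*"
        using b by (auto simp: fam_def de_def)
      have "s \<in> B" using ancestral_rtrancl[OF B(2) s(2)] b by simp
      moreover from this have "s \<in> district G A v"
        using s(1) x sp_district[OF G x _ v(1)] B(1) by auto
      ultimately show False using v(2) by auto
    qed
  qed
  then have "(B - Q) \<union> (Q - pa G x) \<subseteq> verts G - fam x G" using Q A B(1) Q(1)[OF x] by auto
  moreover have "cond_indep M P {x} (pa G x) (verts G - fam x G)"
    using L xA A by (auto simp: local_markov_def)
  moreover have "{x} \<subseteq> verts G" "verts G - fam x G \<subseteq> verts G" using xA A by auto
  ultimately have "cond_indep M P {x} (pa G x) ((B - Q) \<union> (Q - pa G x))"
    using cond_indep_mono[OF J] by (metis order_refl)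
  then have "cond_indep M P {x} (pa G x \<union> (Q - pa G x)) (B - Q)"
    by (rule cond_indep_weak_union[OF J, rotated -1]) (use xA A B Q(1)[OF x] Q(2) in auto)
  moreover have "pa G x \<union> (Q - pa G x) = Q" using Q(1)[OF x] by auto
  ultimately show "cond_indep M P {x} Q (B - Q)" by simp
next
  show "finite (district G A v)" using G A v by (auto simp: admg_def intro: finite_subset)
qed (use A B v Q in \<open>auto simp: disjnt_iff\<close>)

section \<open>Independence from a separating partition\<close>

text \<open>For ancestral \<open>A\<close> this says that \<open>Z\<close> separates
  \<open>X\<close> from \<open>Y\<close> in the augmented graph on \<open>A\<close>, in which each
  district together with its parents is a clique.\<close>

definition separating_partition :: "'v mixed_graph \<Rightarrow> 'v set \<Rightarrow> 'v set \<Rightarrow> 'v set \<Rightarrow> 'v set \<Rightarrow> bool" where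
  "separating_partition G A X Y Z \<longleftrightarrow>
     X \<union> Y \<union> Z = A \<and> disjnt X Y \<and> disjnt X Z \<and> disjnt Y Z \<and>
     (\<forall>v\<in>A. district G A v \<union> (\<Union>x\<in>district G A v. pa G x) \<subseteq> X \<union> Z \<or>
            district G A v \<union> (\<Union>x\<in>district G A v. pa G x) \<subseteq> Y \<union> Z)"

text \<open>Each new district lies with its parents on one side, so \<open>cond_indep_extend\<close>
  adds it to that side, with the whole of \<open>Z\<close> as its \<open>U\<close>.\<close>

lemma separating_partition_cond_indep:
  assumes G: "admg G" "\<not> has_mixed_directed_cycle G"
    and J: "joint_distribution (verts G) M P" and C: "composition_axiom (verts G) M P"
    and L: "local_markov G M P" and A: "A \<subseteq> verts G" "ancestral G A"
    and S: "separating_partition G A X Y Z"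
  shows "cond_indep M P X Z Y"
proof -
  \<comment> \<open>Closure under spouses within \<open>A\<close> makes \<open>B\<close> a union of
    districts of \<open>A\<close>, as \<open>ex_source_district\<close> requires.\<close>
  define good where "good B \<longleftrightarrow> B \<subseteq> A \<and> ancestral G B \<and> (\<forall>x\<in>B. sp G x \<inter> A \<subseteq> B) \<and>
    cond_indep M P (X \<inter> B) (Z \<inter> B) (Y \<inter> B)" for B
  have XYZ: "X \<union> Y \<union> Z = A" "disjnt X Y" "disjnt X Z" "disjnt Y Z"
    using S by (auto simp: separating_partition_def)
  have "finite A" using A(1) G(1) by (auto simp: admg_def intro: finite_subset)
  have grow: "\<exists>B'. good B' \<and> B \<subset> B'" if B: "good B" "B \<subset> A" for B
  proof -
    obtain v where v: "v \<in> A - B" "district G A v \<subseteq> A - B"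
      and pB: "\<And>x. x \<in> district G A v \<Longrightarrow> pa G x \<subseteq> B"
      using ex_source_district[OF G A B(2)] B(1) unfolding good_def by blast
    let ?D = "district G A v"
    define Q where "Q = (\<Union>x\<in>?D. pa G x)"
    have D: "cond_indep M P ?D Q (B - Q)"
      by (rule cond_indep_district[OF G(1) J C L A(1)])
        (use B v pB in \<open>auto simp: good_def Q_def\<close>)
    have Beq: "(X \<inter> B) \<union> (Y \<inter> B) \<union> (Z \<inter> B) = B" "(Y \<inter> B) \<union> (X \<inter> B) \<union> (Z \<inter> B) = B"
      using XYZ(1) B(2) by auto
    have QB: "Q \<subseteq> B" using pB by (auto simp: Q_def)
    have vs: "?D \<subseteq> verts G" "X \<inter> B \<subseteq> verts G" "Y \<inter> B \<subseteq> verts G" "Z \<inter> B \<subseteq> verts G" "Q \<subseteq> verts G"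
      using v A(1) B(2) QB by auto
    have ciB: "cond_indep M P (X \<inter> B) (Z \<inter> B) (Y \<inter> B)" using B(1) by (simp add: good_def)
    have "?D \<union> Q \<subseteq> X \<union> Z \<or> ?D \<union> Q \<subseteq> Y \<union> Z"
      using S v(1) by (auto simp: separating_partition_def Q_def)
    then have "cond_indep M P (X \<inter> (B \<union> ?D)) (Z \<inter> (B \<union> ?D)) (Y \<inter> (B \<union> ?D))"
    proof
      assume DX: "?D \<union> Q \<subseteq> X \<union> Z"
      have "cond_indep M P ((X \<inter> B) \<union> (?D - Z)) ((Z \<inter> B) \<union> (?D \<inter> Z)) (Y \<inter> B)"
        by (rule cond_indep_extend[OF J vs ciB]) (use D DX QB XYZ(2-4) Beq in \<open>auto simp: disjnt_iff\<close>)
      moreover have "(X \<inter> B) \<union> (?D - Z) = X \<inter> (B \<union> ?D)" "(Z \<inter> B) \<union> (?D \<inter> Z) = Z \<inter> (B \<union> ?D)"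
        "Y \<inter> B = Y \<inter> (B \<union> ?D)"
        using DX XYZ(2-4) by (auto simp: disjnt_iff)
      ultimately show ?thesis by simp
    next
      assume DY: "?D \<union> Q \<subseteq> Y \<union> Z"
      have "cond_indep M P ((Y \<inter> B) \<union> (?D - Z)) ((Z \<inter> B) \<union> (?D \<inter> Z)) (X \<inter> B)"
        by (rule cond_indep_extend[OF J vs(1,3,2,4,5) cond_indep_sym[OF ciB]])
          (use D DY QB XYZ(2-4) Beq in \<open>auto simp: disjnt_iff\<close>)
      moreover have "(Y \<inter> B) \<union> (?D - Z) = Y \<inter> (B \<union> ?D)" "(Z \<inter> B) \<union> (?D \<inter> Z) = Z \<inter> (B \<union> ?D)"
        "X \<inter> B = X \<inter> (B \<union> ?D)"
        using DY XYZ(2-4) by (auto simp: disjnt_iff)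
      ultimately show ?thesis using cond_indep_sym by metis
    qed
    moreover have "ancestral G (B \<union> ?D)" using B(1) pB by (auto simp: good_def ancestral_def)
    moreover have "\<forall>x\<in>B \<union> ?D. sp G x \<inter> A \<subseteq> B \<union> ?D"
      using B(1) v(1) sp_district[OF G(1)] unfolding good_def by blast
    ultimately have "good (B \<union> ?D)" using B(2) v by (auto simp: good_def)
    moreover have "v \<in> ?D" by (simp add: district_def)
    ultimately show ?thesis using v by blast
  qed
  have "good {}" using cond_indep_empty[OF J, of "{}" "{}"] by (auto simp: good_def ancestral_def)
  moreover have "finite {B. good B}"
    using \<open>finite A\<close> by (auto simp: good_def intro: finite_subset[of _ "Pow A"])
  \<comment> \<open>A maximal good set exists since \<open>A\<close> is finite, and
    \<open>grow\<close> leaves only \<open>A\<close> itself.\<close>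
  ultimately obtain B where "good B" and max: "\<And>B'. good B' \<Longrightarrow> B \<subseteq> B' \<Longrightarrow> B = B'"
    using finite_has_maximal[of "{B. good B}"] by blast
  then have "B = A" using grow[of B] unfolding good_def by blast
  moreover have "X \<inter> A = X" "Y \<inter> A = Y" "Z \<inter> A = Z" using XYZ(1) by auto
  ultimately show ?thesis using \<open>good B\<close> by (simp add: good_def)
qed

section \<open>Reachability inside the ancestral set\<close>

text \<open>No vertex on the directed path lies in \<open>Z\<close>, since \<open>v\<close> would be
  its ancestor, and a \<open>Fwd\<close> edge never leaves a collider behind.\<close>

lemma m_reach_descend:
  assumes "m_reach G X Z v h" "v \<notin> (\<Union>z\<in>Z. an G z)" "(v, w) \<in> (dir G)\<^sup>*"
  shows "\<exists>h. m_reach G X Z w h"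
  using assms(3)
proof induction
  case (step y z)
  then obtain h where h: "m_reach G X Z y h" by blast
  have "y \<notin> Z"
    using assms(2) step(1) by (auto simp: an_def)
  then have "m_reach G X Z z (Fwd \<in> {Fwd, Bi})"
    using step(2) h by (intro m_reach.step[where e = Fwd]) auto
  then show ?case by blast
qed (use assms in blast)

text \<open>The path is traversed backwards from \<open>x\<close>; its vertices are descendants of
  \<open>v\<close> and so outside \<open>Z\<close>. Arrival by a tail gives the flag
  \<open>False\<close>, so \<open>v\<close> can then be left along any edge as a
  non-collider.\<close>

lemma m_reach_ascend:
  assumes "x \<in> X" "v \<notin> (\<Union>z\<in>Z. an G z)" "(v, x) \<in> (dir G)\<^sup>*"
  shows "m_reach G X Z v False"
  using assms(3,2)
proof (induction rule: converse_rtrancl_induct)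
  case base
  then show ?case using assms(1) by (simp add: m_reach.start)
next
  case (step y z)
  then have z: "z \<notin> (\<Union>z\<in>Z. an G z)"
    by (auto simp: an_def intro: converse_rtrancl_into_rtrancl)
  then have "z \<notin> Z" by (auto simp: an_def)
  then have "m_reach G X Z y (Bwd \<in> {Fwd, Bi})"
    using step z by (intro m_reach.step[where e = Bwd]) auto
  then show ?case by simp
qed

text \<open>
  A collider \<open>v\<close> that is no ancestor of \<open>Z\<close> has a directed path avoiding \<open>Z\<close> to \<open>Y\<close>, contradicting
  separation, or to \<open>X\<close>, and then the walk can be restarted by ascending that path to \<open>v\<close>.
\<close>

lemma m_reach_collider_step:
  assumes r: "m_reach G X Z v h" and v: "v \<in> (\<Union>x\<in>X \<union> Y \<union> Z. an G x)"
    and Y: "\<And>y h. y \<in> Y \<Longrightarrow> \<not> m_reach G X Z y h"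
    and e: "has_edge G v e w" "v \<notin> Z \<or> h \<and> e \<in> {Bwd, Bi}"
  shows "m_reach G X Z w (e \<in> {Fwd, Bi})"
proof (cases "h \<and> e \<in> {Bwd, Bi}")
  case False
  then have "v \<notin> Z" using e(2) by blast
  then show ?thesis by (intro m_reach.step[OF r e(1)]) (simp only: if_not_P[OF False] not_False_eq_True)
next
  case True
  show ?thesis
  proof (cases "v \<in> (\<Union>z\<in>Z. an G z)")
    case v': True
    show ?thesis by (rule m_reach.step[OF r e(1)]) (simp only: if_P[OF True] v')
  next
    case v': False
    have "\<not> (\<exists>y\<in>Y. v \<in> an G y)" using m_reach_descend[OF r v'] Y by (auto simp: an_def)
    then obtain x where "x \<in> X" "v \<in> an G x" using v v' by auto
    then have "m_reach G X Z v False" using m_reach_ascend[OF _ v'] by (auto simp: an_def)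
    moreover have "v \<notin> Z" using v' by (auto simp: an_def)
    ultimately show ?thesis by (intro m_reach.step[OF _ e(1)]) auto
  qed
qed

text \<open>From \<open>u\<close> the walk runs along the bi-directed edges of the district and, if
  need be, back to a parent. Vertices of \<open>Z\<close> on the way are met as colliders, and
  \<open>m_reach_collider_step\<close> gets past them.\<close>

lemma m_reach_district:
  assumes G: "admg G"
    and Y: "\<And>y h. y \<in> Y \<Longrightarrow> \<not> m_reach G X Z y h"
    and A: "A = (\<Union>x\<in>X \<union> Y \<union> Z. an G x)"
    and v: "v \<in> A"
    and u: "u \<in> district G A v \<union> (\<Union>x\<in>district G A v. pa G x)" "u \<notin> Z" "m_reach G X Z u h"
    and w: "w \<in> district G A v \<union> (\<Union>x\<in>district G A v. pa G x)"
  shows "\<exists>h. m_reach G X Z w h"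
proof -
  note cstep = m_reach_collider_step[where G = G and X = X and Y = Y and Z = Z, folded A, OF _ _ Y]
  have sy: "sym (bidir G \<inter> A \<times> A)" using G by (auto simp: admg_def sym_def)
  obtain d where d: "d \<in> district G A v" "d = u \<or> u \<in> pa G d" using u(1) by auto
  have dA: "d \<in> A" using d(1) district_subset[OF v] by auto
  have uA: "u \<in> A" using d(2) dA unfolding A by (auto simp: an_def pa_def intro: converse_rtrancl_into_rtrancl)
  \<comment> \<open>A vertex of \<open>Z\<close> can be left only as a collider, so the disjunction
    demands that it was entered by an arrowhead.\<close>
  have dd: "\<exists>h. m_reach G X Z d h \<and> (d \<notin> Z \<or> h)"
  proof (cases "d = u")
    case True
    then show ?thesis using u(2,3) by auto
  next
    case False
    then have "has_edge G u Fwd d" using d(2) by (simp add: pa_def)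
    then have "m_reach G X Z d (Fwd \<in> {Fwd, Bi})" using u(2) uA by (intro cstep[OF u(3)]) auto
    then show ?thesis by auto
  qed
  have D: "\<exists>h. m_reach G X Z y h \<and> (y \<notin> Z \<or> h)" if y: "y \<in> district G A v" for y
  proof -
    have "(d, v) \<in> (bidir G \<inter> A \<times> A)\<^sup>*"
      using d(1) sy by (auto simp: district_def dest: symD[OF sym_rtrancl])
    then have "(d, y) \<in> (bidir G \<inter> A \<times> A)\<^sup>*" using y by (auto simp: district_def)
    then show ?thesis
    proof induction
      case (step y z)
      then obtain h where h: "m_reach G X Z y h" "y \<notin> Z \<or> h" by auto
      have "m_reach G X Z z (Bi \<in> {Fwd, Bi})"
        using step(2) h(2) by (intro cstep[OF h(1)]) auto
      then show ?case by auto
    qed (use dd in auto)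
  qed
  from w show ?thesis
  proof
    assume "w \<in> district G A v"
    then show ?thesis using D by blast
  next
    assume "w \<in> (\<Union>x\<in>district G A v. pa G x)"
    then obtain x where x: "x \<in> district G A v" "w \<in> pa G x" by auto
    then obtain h where h: "m_reach G X Z x h" "x \<notin> Z \<or> h" using D by blast
    have "m_reach G X Z w (Bwd \<in> {Fwd, Bi})"
      using h x district_subset[OF v] by (intro cstep[OF h(1)]) (auto simp: pa_def)
    then show ?thesis by auto
  qed
qed

text \<open>By \<open>m_reach_district\<close>, a district with its parents is, outside
  \<open>Z\<close>, either wholly reached from \<open>X\<close> or not at all, so reachability
  splits \<open>A - Z\<close> as required.\<close>

lemma ex_separating_partition:
  assumes G: "admg G" and V: "X \<subseteq> verts G"
    and dis: "disjnt X Y" "disjnt X Z" "disjnt Y Z" and sep: "m_separated G X Y Z"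
    and A: "A = (\<Union>x\<in>X \<union> Y \<union> Z. an G x)"
  shows "\<exists>X' Y'. X \<subseteq> X' \<and> Y \<subseteq> Y' \<and> separating_partition G A X' Y' Z"
proof -
  define X' where "X' = {v \<in> A - Z. \<exists>h. m_reach G X Z v h}"
  define Y' where "Y' = A - Z - X'"
  have Y: "\<not> m_reach G X Z y h" if "y \<in> Y" for y h
    using sep that m_separated_iff_m_reach[OF G V dis(2)] by blast
  have sub: "X \<subseteq> A" "Y \<subseteq> A" "Z \<subseteq> A" unfolding A by (auto simp: an_def)
  have "X \<subseteq> X'" using sub dis by (auto simp: X'_def disjnt_iff intro: m_reach.start)
  moreover have "Y \<subseteq> Y'" using sub dis Y by (auto simp: X'_def Y'_def disjnt_iff)
  moreover have "separating_partition G A X' Y' Z"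
    unfolding separating_partition_def
  proof (intro conjI ballI)
    fix v assume v: "v \<in> A"
    let ?E = "district G A v \<union> (\<Union>x\<in>district G A v. pa G x)"
    have E: "?E \<subseteq> A" using district_subset[OF v]
      unfolding A by (fastforce simp: an_def pa_def intro: converse_rtrancl_into_rtrancl)
    show "?E \<subseteq> X' \<union> Z \<or> ?E \<subseteq> Y' \<union> Z"
    proof (cases "\<exists>u\<in>?E. u \<in> X'")
      case True
      then obtain u h where "u \<in> ?E" "u \<notin> Z" "m_reach G X Z u h" by (auto simp: X'_def)
      from m_reach_district[OF G Y A v this] show ?thesis using E by (auto simp: X'_def)
    next
      case False
      then show ?thesis using E by (auto simp: Y'_def)
    qed
  qed (use sub in \<open>auto simp: X'_def Y'_def disjnt_iff\<close>)
  ultimately show ?thesis by blast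
qed

section \<open>The two implications between the Markov properties\<close>

lemma local_markov_imp_global_markov:
  assumes G: "admg G" "\<not> has_mixed_directed_cycle G"
    and J: "joint_distribution (verts G) M P" and C: "composition_axiom (verts G) M P"
    and L: "local_markov G M P"
  shows "global_markov G M P"
  unfolding global_markov_def
proof (intro allI impI, elim conjE)
  fix X Y Z
  assume V: "X \<subseteq> verts G" "Y \<subseteq> verts G" "Z \<subseteq> verts G"
    and dis: "disjnt X Y" "disjnt X Z" "disjnt Y Z" and sep: "m_separated G X Y Z"
  define A where "A = (\<Union>x\<in>X \<union> Y \<union> Z. an G x)"
  have "ancestral G A"
    unfolding A_def by (auto simp: ancestral_def an_def pa_def intro: converse_rtrancl_into_rtrancl)
  moreover have A: "A \<subseteq> verts G"
  proof
    fix a assume "a \<in> A"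
    then obtain x where "x \<in> verts G" "(a, x) \<in> (dir G)\<^sup>*" using V by (auto simp: A_def an_def)
    then show "a \<in> verts G" using G(1) by (auto simp: admg_def elim: converse_rtranclE)
  qed
  moreover obtain X' Y' where XY: "X \<subseteq> X'" "Y \<subseteq> Y'" and S: "separating_partition G A X' Y' Z"
    using ex_separating_partition[OF G(1) V(1) dis sep A_def] by blast
  ultimately have "cond_indep M P X' Z Y'" by (intro separating_partition_cond_indep[OF G J C L])
  moreover have "X' \<subseteq> verts G" "Y' \<subseteq> verts G" using S A by (auto simp: separating_partition_def)
  ultimately show "cond_indep M P X Z Y" using cond_indep_mono[OF J] XY by blast
qed

lemma global_markov_imp_local_markov:
  assumes G: "admg G" "\<not> has_mixed_directed_cycle G" and "global_markov G M P"
  shows "local_markov G M P"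
  unfolding local_markov_def
proof
  fix x assume x: "x \<in> verts G"
  have "pa G x \<subseteq> verts G" using G(1) by (auto simp: admg_def pa_def)
  moreover have "disjnt {x} (verts G - fam x G)" "disjnt (verts G - fam x G) (pa G x)"
    by (auto simp: disjnt_iff fam_def de_def)
  moreover have "disjnt {x} (pa G x)" using G(1) by (auto simp: pa_def admg_def acyclic_def)
  ultimately show "cond_indep M P {x} (pa G x) (verts G - fam x G)"
    using assms(3) m_separated_parents[OF G x] x by (simp add: global_markov_def)
qed

theorem theorem2:
  fixes G :: "'v mixed_graph" and M :: "'v \<Rightarrow> 'a measure"
  assumes "admg G"
    and "\<not> has_mixed_directed_cycle G"
  shows "P_l_comp G M = P_m_comp G M"
  using local_markov_imp_global_markov[OF assms] global_markov_imp_local_markov[OF assms]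
  unfolding P_l_comp_def P_m_comp_def by blast

end
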